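(* Suppose that $n$ is odd, $k$ is even, $0<k<n$, and $k\ne 4$. Then the element $V$ (the volume of an $n$-simplex) is not integral over the ring $R_k$ generated over $\mathbb{Q}$ by the $k$-volumes of all $k$-faces of the simplex.
   Context: Let $\ell_{ij}=\ell_{ji}$, $0\le i<j\le n$, be $\binom{n+1}{2}$ independent variables over $\mathbb{Q}$ (the edge lengths of an $n$-simplex with vertices $p_0,\dots,p_n$), and let $\mathbb{F}$ be the algebraic closure of the field of rational functions $\mathbb{Q}(\ell_{ij})$. For a subset $\{i_0,\dots,i_k\}\subset\{0,\dots,n\}$ of cardinality $k+1$ let $$S_{i_0\ldots i_k}=\frac{(-1)^{k+1}}{2^k(k!)^2}\det M_{i_0\ldots i_k},$$ where $M_{i_0\ldots i_k}$ is the symmetric $(k+2)\times(k+2)$ matrix with rows and columns indexed by $*,i_0,\dots,i_k$, with $( *,* )$ entry $0$, $( *,i)$ and $(i,* )$ entries $1$, $(i,i)$ entries $0$, and $(i,j)$ entries $\ell_{ij}^2$ for $i\ne j$ (Cayley--Menger formula for the square of the $k$-volume of the face with vertices $p_{i_0},\dots,p_{i_k}$). Put $A_{i_0\ldots i_k}=\sqrt{S_{i_0\ldots i_k}}\in\mathbb{F}$, $W=S_{01\ldots n}$, and $V=\sqrt{W}\in\mathbb{F}$. $R_k$ is the $\mathbb{Q}$-subalgebra of $\mathbb{F}$ generated by all $\binom{n+1}{k+1}$ elements $A_{i_0\ldots i_k}$. *)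

theory Defs
  imports
    "HOL-Computational_Algebra.Polynomial"
    "HOL-Library.Poly_Mapping"
    "Jordan_Normal_Form.Determinant"
begin

definition is_subfield :: "'a::field set \<Rightarrow> bool" where
  "is_subfield K \<longleftrightarrow> 0 \<in> K \<and> 1 \<in> K \<and>
     (\<forall>x\<in>K. \<forall>y\<in>K. x + y \<in> K \<and> x * y \<in> K) \<and>
     (\<forall>x\<in>K. - x \<in> K \<and> inverse x \<in> K)"

definition is_rat_subalgebra :: "'a::field_char_0 set \<Rightarrow> bool" where
  "is_rat_subalgebra R \<longleftrightarrow> range of_rat \<subseteq> R \<and>
     (\<forall>x\<in>R. \<forall>y\<in>R. x + y \<in> R \<and> x * y \<in> R)"

definition algebraic_over :: "'a::field set \<Rightarrow> 'a \<Rightarrow> bool" where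
  "algebraic_over K x \<longleftrightarrow> (\<exists>p. p \<noteq> 0 \<and> (\<forall>i. coeff p i \<in> K) \<and> poly p x = 0)"

definition integral_over :: "'a::comm_ring_1 set \<Rightarrow> 'a \<Rightarrow> bool" where
  "integral_over R x \<longleftrightarrow> (\<exists>p. lead_coeff p = 1 \<and> (\<forall>i. coeff p i \<in> R) \<and> poly p x = 0)"

text \<open>
  A multivariate polynomial over the rationals with variables in \<open>'v\<close> is a finitely supported
  map from monomials (finitely supported exponent functions) to coefficients.
\<close>

definition rat_mpoly_eval ::
    "('v \<Rightarrow> 'a::field_char_0) \<Rightarrow> (('v \<Rightarrow>\<^sub>0 nat) \<Rightarrow>\<^sub>0 rat) \<Rightarrow> 'a" where
  "rat_mpoly_eval x p =
     (\<Sum>m\<in>Poly_Mapping.keys p. of_rat (Poly_Mapping.lookup p m) *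
        (\<Prod>v\<in>Poly_Mapping.keys m. x v ^ Poly_Mapping.lookup m v))"

definition alg_independent_rat :: "'v set \<Rightarrow> ('v \<Rightarrow> 'a::field_char_0) \<Rightarrow> bool" where
  "alg_independent_rat B x \<longleftrightarrow>
     (\<forall>p. (\<forall>m\<in>Poly_Mapping.keys p. Poly_Mapping.keys m \<subseteq> B) \<longrightarrow>
          rat_mpoly_eval x p = 0 \<longrightarrow> p = 0)"

definition edges :: "nat \<Rightarrow> (nat \<times> nat) set" where
  "edges n = {(i, j). i < j \<and> j \<le> n}"

definition faces :: "nat \<Rightarrow> nat \<Rightarrow> nat set set" where
  "faces n k = {I. I \<subseteq> {0..n} \<and> card I = k + 1}"

text \<open>
  Row and column \<open>0\<close> carry the index \<open>*\<close>; row and column \<open>r > 0\<close> carry the \<open>r\<close>-th smallest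
  vertex of \<open>I\<close>.
\<close>

definition cayley_menger_mat :: "(nat \<Rightarrow> nat \<Rightarrow> 'a::field_char_0) \<Rightarrow> nat set \<Rightarrow> 'a mat" where
  "cayley_menger_mat l I = (let vs = sorted_list_of_set I in
     mat (card I + 1) (card I + 1) (\<lambda>(r, c).
       if r = c then 0
       else if r = 0 \<or> c = 0 then 1
       else (l (vs ! (r - 1)) (vs ! (c - 1)))\<^sup>2))"

definition sq_volume :: "(nat \<Rightarrow> nat \<Rightarrow> 'a::field_char_0) \<Rightarrow> nat set \<Rightarrow> 'a" where
  "sq_volume l I = (let k = card I - 1 in
     (- 1) ^ (k + 1) / (2 ^ k * (fact k)\<^sup>2) * det (cayley_menger_mat l I))"

end

theory Submission
  imports Defs
begin

text \<open>
  A monic equation for \<open>V\<close> bounds \<open>V\<close> whenever the volumes of the faces are bounded. The proof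
  therefore looks for edge lengths that keep the volumes of all even-dimensional faces fixed while
  the volume of the whole simplex varies. Such lengths exist for odd \<open>n\<close>: group the \<open>n + 1\<close> vertices
  by parity, put vertices of equal parity at distance \<open>0\<close>, and let the squared distances between
  the two classes be the entries of \<open>1 + s J\<close>, where \<open>1\<close> is the identity matrix, \<open>J\<close> the
  all-ones matrix and \<open>s\<close> a parameter.

  A face of even dimension has an odd number of vertices, so the vertices of one class outnumber the
  others. In the Cayley--Menger matrix the border can be used to move the parameter out of the
  mixed blocks and into the diagonal block of the smaller class. The larger class contributes a zero
  block of at least half the size of the matrix, and then no term of the Leibniz formula reaches
  the block that contains the parameter; this is \<open>det_bordered_shift\<close>, which yields
  \<open>family_det_even_face\<close>. For the full simplex the two classes have equal size, and the
  determinant is a polynomial in \<open>s\<close> that vanishes at one parameter but not at another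
  (\<open>family_det_full_root\<close>, \<open>family_det_full_0\<close>), hence takes infinitely many values.

  It remains to carry an integral equation over to the family. Taking norms removes the square
  roots \<open>A I\<close> from its coefficients one by one (\<open>integral_over_remove_sqrts\<close>), so that \<open>V\<close>
  satisfies a monic equation whose coefficients are rational polynomials in the edge lengths that are
  constant along the family, as the squared face volumes are.
  As the edge lengths are algebraically independent, the resulting identity for \<open>V\<^sup>2\<close> persists
  when the lengths of the family are substituted (\<open>integral_equation_transfer\<close>). The coefficients
  become constants, which leaves only finitely many values for the squared volume: a contradiction.
\<close>

section \<open>Polynomial functions with rational coefficients\<close>

text \<open>
  Polynomials enter only through the functions that they define, so that sums, products and
  determinants are covered by closure properties and substitution is application.
\<close>

definition rat_poly_fun :: "'v set \<Rightarrow> (('v \<Rightarrow> 'a::field_char_0) \<Rightarrow> 'a) \<Rightarrow> bool" where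
  "rat_poly_fun B f \<longleftrightarrow>
     (\<exists>p. (\<forall>m\<in>Poly_Mapping.keys p. Poly_Mapping.keys m \<subseteq> B) \<and> f = (\<lambda>x. rat_mpoly_eval x p))"

definition monom_eval :: "('v \<Rightarrow> 'a::field_char_0) \<Rightarrow> ('v \<Rightarrow>\<^sub>0 nat) \<Rightarrow> 'a" where
  "monom_eval x m = (\<Prod>v\<in>Poly_Mapping.keys m. x v ^ Poly_Mapping.lookup m v)"

lemma monom_eval_superset:
  assumes "finite A" and "Poly_Mapping.keys m \<subseteq> A"
  shows "monom_eval x m = (\<Prod>v\<in>A. x v ^ Poly_Mapping.lookup m v)"
  unfolding monom_eval_def
  by (rule prod.mono_neutral_left) (use assms in \<open>auto simp: in_keys_iff\<close>)

lemma monom_eval_add: "monom_eval x (a + b) = monom_eval x a * monom_eval x b"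
proof -
  let ?A = "Poly_Mapping.keys a \<union> Poly_Mapping.keys b"
  have "monom_eval x (a + b) = (\<Prod>v\<in>?A. x v ^ Poly_Mapping.lookup (a + b) v)"
    by (rule monom_eval_superset) (use keys_add[of a b] in auto)
  then show ?thesis
    by (simp add: monom_eval_superset[of ?A] lookup_add power_add prod.distrib)
qed

lemma rat_mpoly_eval_superset:
  assumes "finite A" and "Poly_Mapping.keys p \<subseteq> A"
  shows "rat_mpoly_eval x p = (\<Sum>m\<in>A. of_rat (Poly_Mapping.lookup p m) * monom_eval x m)"
  unfolding rat_mpoly_eval_def monom_eval_def
  by (rule sum.mono_neutral_left) (use assms in \<open>auto simp: in_keys_iff\<close>)

lemma rat_mpoly_eval_add: "rat_mpoly_eval x (p + q) = rat_mpoly_eval x p + rat_mpoly_eval x q"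
proof -
  let ?A = "Poly_Mapping.keys p \<union> Poly_Mapping.keys q"
  have "rat_mpoly_eval x (p + q) =
      (\<Sum>m\<in>?A. of_rat (Poly_Mapping.lookup (p + q) m) * monom_eval x m)"
    by (rule rat_mpoly_eval_superset) (use keys_add[of p q] in auto)
  then show ?thesis
    by (simp add: rat_mpoly_eval_superset[of ?A] lookup_add of_rat_add distrib_right sum.distrib)
qed

lemma rat_mpoly_eval_0: "rat_mpoly_eval x 0 = 0"
  by (simp add: rat_mpoly_eval_def)

lemma rat_mpoly_eval_single:
  "rat_mpoly_eval x (Poly_Mapping.single m c) = of_rat c * monom_eval x m"
  by (simp add: rat_mpoly_eval_def monom_eval_def)

lemma rat_mpoly_eval_sum: "rat_mpoly_eval x (\<Sum>i\<in>I. p i) = (\<Sum>i\<in>I. rat_mpoly_eval x (p i))"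
  by (induction I rule: infinite_finite_induct) (simp_all add: rat_mpoly_eval_add rat_mpoly_eval_0)

lemma poly_mapping_sum_singles:
  "p = (\<Sum>m\<in>Poly_Mapping.keys p. Poly_Mapping.single m (Poly_Mapping.lookup p m))"
proof (rule poly_mapping_eqI)
  fix m
  show "Poly_Mapping.lookup p m = Poly_Mapping.lookup
      (\<Sum>m\<in>Poly_Mapping.keys p. Poly_Mapping.single m (Poly_Mapping.lookup p m)) m"
    by (simp add: lookup_sum lookup_single when_def in_keys_iff)
qed

lemma rat_mpoly_eval_mult: "rat_mpoly_eval x (p * q) = rat_mpoly_eval x p * rat_mpoly_eval x q"
proof -
  have "p * q =
      (\<Sum>a\<in>Poly_Mapping.keys p. Poly_Mapping.single a (Poly_Mapping.lookup p a)) *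
      (\<Sum>b\<in>Poly_Mapping.keys q. Poly_Mapping.single b (Poly_Mapping.lookup q b))"
    using poly_mapping_sum_singles[of p] poly_mapping_sum_singles[of q] by simp
  also have "\<dots> = (\<Sum>a\<in>Poly_Mapping.keys p. \<Sum>b\<in>Poly_Mapping.keys q.
      Poly_Mapping.single (a + b) (Poly_Mapping.lookup p a * Poly_Mapping.lookup q b))"
    by (simp add: sum_product mult_single)
  finally have "rat_mpoly_eval x (p * q) =
      (\<Sum>a\<in>Poly_Mapping.keys p. \<Sum>b\<in>Poly_Mapping.keys q.
        (of_rat (Poly_Mapping.lookup p a) * monom_eval x a) *
        (of_rat (Poly_Mapping.lookup q b) * monom_eval x b))"
    by (simp add: rat_mpoly_eval_sum rat_mpoly_eval_single monom_eval_add of_rat_mult ac_simps)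
  then show ?thesis
    by (simp add: sum_product rat_mpoly_eval_superset[OF finite_keys subset_refl])
qed

lemma rat_poly_fun_const: "rat_poly_fun B (\<lambda>x. of_rat c)"
  unfolding rat_poly_fun_def
  by (rule exI[of _ "Poly_Mapping.single 0 c"]) (simp add: rat_mpoly_eval_single monom_eval_def)

lemma rat_poly_fun_var: "v \<in> B \<Longrightarrow> rat_poly_fun B (\<lambda>x. x v)"
  unfolding rat_poly_fun_def
  by (rule exI[of _ "Poly_Mapping.single (Poly_Mapping.single v 1) 1"])
    (simp add: rat_mpoly_eval_single monom_eval_def)

lemma rat_poly_fun_add:
  assumes "rat_poly_fun B f" and "rat_poly_fun B g"
  shows "rat_poly_fun B (\<lambda>x. f x + g x)"
proof -
  from assms obtain p q where
    "\<forall>m\<in>Poly_Mapping.keys p. Poly_Mapping.keys m \<subseteq> B" "f = (\<lambda>x. rat_mpoly_eval x p)"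
    "\<forall>m\<in>Poly_Mapping.keys q. Poly_Mapping.keys m \<subseteq> B" "g = (\<lambda>x. rat_mpoly_eval x q)"
    unfolding rat_poly_fun_def by blast
  then show ?thesis
    unfolding rat_poly_fun_def using keys_add[of p q]
    by (intro exI[of _ "p + q"]) (auto simp: rat_mpoly_eval_add)
qed

lemma rat_poly_fun_mult:
  assumes "rat_poly_fun B f" and "rat_poly_fun B g"
  shows "rat_poly_fun B (\<lambda>x. f x * g x)"
proof -
  from assms obtain p q where p:
    "\<forall>m\<in>Poly_Mapping.keys p. Poly_Mapping.keys m \<subseteq> B" "f = (\<lambda>x. rat_mpoly_eval x p)"
    "\<forall>m\<in>Poly_Mapping.keys q. Poly_Mapping.keys m \<subseteq> B" "g = (\<lambda>x. rat_mpoly_eval x q)"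
    unfolding rat_poly_fun_def by blast
  have "Poly_Mapping.keys m \<subseteq> B" if m: "m \<in> Poly_Mapping.keys (p * q)" for m
  proof -
    from m keys_mult[of p q] obtain a b where
      "m = a + b" "a \<in> Poly_Mapping.keys p" "b \<in> Poly_Mapping.keys q" by blast
    with p keys_add[of a b] show ?thesis by blast
  qed
  with p show ?thesis
    unfolding rat_poly_fun_def by (intro exI[of _ "p * q"]) (auto simp: rat_mpoly_eval_mult)
qed

lemma rat_poly_fun_sum:
  "(\<And>i. i \<in> I \<Longrightarrow> rat_poly_fun B (f i)) \<Longrightarrow> rat_poly_fun B (\<lambda>x. \<Sum>i\<in>I. f i x)"
proof (induction I rule: infinite_finite_induct)
  case (insert i I)
  then show ?case using rat_poly_fun_add[of B "f i"] by simp
qed (use rat_poly_fun_const[of B 0] in simp_all)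

lemma rat_poly_fun_prod:
  "(\<And>i. i \<in> I \<Longrightarrow> rat_poly_fun B (f i)) \<Longrightarrow> rat_poly_fun B (\<lambda>x. \<Prod>i\<in>I. f i x)"
proof (induction I rule: infinite_finite_induct)
  case (insert i I)
  then show ?case using rat_poly_fun_mult[of B "f i"] by simp
qed (use rat_poly_fun_const[of B 1] in simp_all)

lemma rat_poly_fun_power: "rat_poly_fun B f \<Longrightarrow> rat_poly_fun B (\<lambda>x. f x ^ e)"
  using rat_poly_fun_prod[of "{..<e}" B "\<lambda>_. f"] by simp

text \<open>
  An algebraically independent point is generic: the difference of two polynomial functions that
  agree there comes from the zero polynomial, so the functions agree at every other point.
\<close>

lemma rat_poly_fun_eq_transfer:
  assumes "alg_independent_rat B x" and "rat_poly_fun B f" and "rat_poly_fun B g"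
    and "f x = g x"
  shows "f y = g y"
proof -
  have "rat_poly_fun B (\<lambda>x. f x + of_rat (- 1) * g x)"
    by (intro rat_poly_fun_add rat_poly_fun_mult rat_poly_fun_const assms)
  then obtain p where p: "\<forall>m\<in>Poly_Mapping.keys p. Poly_Mapping.keys m \<subseteq> B"
    and eval: "(\<lambda>x. f x + of_rat (- 1) * g x) = (\<lambda>x. rat_mpoly_eval x p)"
    unfolding rat_poly_fun_def by blast
  from fun_cong[OF eval, of x] assms(4) have "rat_mpoly_eval x p = 0" by (simp add: of_rat_minus)
  with assms(1) p have "p = 0" unfolding alg_independent_rat_def by blast
  with fun_cong[OF eval, of y] show ?thesis by (simp add: rat_mpoly_eval_0 of_rat_minus)
qed

section \<open>Removing adjoined square roots from an integral equation\<close>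

lemma rat_subalgebraD:
  assumes "is_rat_subalgebra R"
  shows "0 \<in> R" and "1 \<in> R" and "x \<in> R \<Longrightarrow> y \<in> R \<Longrightarrow> x + y \<in> R"
    and "x \<in> R \<Longrightarrow> y \<in> R \<Longrightarrow> x * y \<in> R" and "x \<in> R \<Longrightarrow> - x \<in> R"
proof -
  have rat: "of_rat q \<in> R" for q using assms unfolding is_rat_subalgebra_def by blast
  show "0 \<in> R" "1 \<in> R" using rat[of 0] rat[of 1] by simp_all
  show mult: "x \<in> R \<Longrightarrow> y \<in> R \<Longrightarrow> x * y \<in> R" and "x \<in> R \<Longrightarrow> y \<in> R \<Longrightarrow> x + y \<in> R" for x y
    using assms unfolding is_rat_subalgebra_def by blast+
  show "x \<in> R \<Longrightarrow> - x \<in> R" using mult[OF rat[of "- 1"], of x] by (simp add: of_rat_minus)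
qed

lemma rat_subalgebra_sum:
  assumes "is_rat_subalgebra R" and "\<And>i. i \<in> I \<Longrightarrow> f i \<in> R"
  shows "sum f I \<in> R"
  using assms(2)
  by (induction I rule: infinite_finite_induct) (auto intro: rat_subalgebraD[OF assms(1)])

lemma coeff_mult_in_rat_subalgebra:
  assumes "is_rat_subalgebra R" and "\<And>i. coeff p i \<in> R" and "\<And>i. coeff q i \<in> R"
  shows "coeff (p * q) i \<in> R"
  unfolding coeff_mult
  by (intro rat_subalgebra_sum[OF assms(1)] rat_subalgebraD(4)[OF assms(1)] assms)

lemma integral_over_mono: "integral_over R v \<Longrightarrow> R \<subseteq> S \<Longrightarrow> integral_over S v"
  unfolding integral_over_def by blast

text \<open>
  This is the norm from \<open>R[x]\<close> to \<open>R\<close>. A monic equation over \<open>R[x]\<close> has the form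
  \<open>P + x Q\<close> with \<open>P\<close>, \<open>Q\<close> over \<open>R\<close>; multiplying it by its conjugate \<open>P - x Q\<close> gives
  \<open>P\<^sup>2 - x\<^sup>2 Q\<^sup>2\<close>, which is over \<open>R\<close>. If \<open>P\<close> carries the whole leading term, then \<open>Q\<close> has
  smaller degree and the product stays monic.
\<close>

lemma integral_over_remove_sqrt:
  fixes R :: "'a::field_char_0 set"
  assumes R: "is_rat_subalgebra R" and x: "x\<^sup>2 \<in> R"
    and int: "integral_over {a + b * x | a b. a \<in> R \<and> b \<in> R} v"
  shows "integral_over R v"
proof -
  from int obtain p where monic: "lead_coeff p = 1" and root: "poly p v = 0"
    and "\<forall>i. \<exists>a b. coeff p i = a + b * x \<and> a \<in> R \<and> b \<in> R"
    unfolding integral_over_def by blast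
  then obtain a b where ab: "\<And>i. coeff p i = a i + b i * x" "\<And>i. a i \<in> R" "\<And>i. b i \<in> R"
    by metis
  define N where "N = degree p"
  (* The representation of a coefficient as a + b x may not be unique, so a N and b N could be
     different from 1 and 0; the leading term is therefore put into P by hand. *)
  define P where "P = monom 1 N + (\<Sum>i<N. monom (a i) i)"
  define Q where "Q = (\<Sum>i<N. monom (b i) i)"
  define q where "q = P * P - smult (x\<^sup>2) (Q * Q)"
  have coeff_P: "coeff P i = (if i = N then 1 else if i < N then a i else 0)" for i
    by (auto simp: P_def coeff_sum)
  have coeff_Q: "coeff Q i = (if i < N then b i else 0)" for i
    by (auto simp: Q_def coeff_sum)
  have "p = P + smult x Q"
  proof (rule poly_eqI)
    fix i
    show "coeff p i = coeff (P + smult x Q) i"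
      using monic ab(1)[of i] coeff_eq_0[of p i]
      by (cases i N rule: linorder_cases) (auto simp: coeff_P coeff_Q N_def)
  qed
  then have "q = p * (P - smult x Q)"
    by (simp add: q_def algebra_simps power2_eq_square)
  then have "poly q v = 0" using root by simp
  moreover have "lead_coeff q = 1"
  proof -
    have P: "degree P = N" "lead_coeff P = 1"
    proof -
      show "degree P = N"
        by (rule antisym) (auto intro!: degree_le le_degree simp: coeff_P)
      then show "lead_coeff P = 1" by (simp add: coeff_P)
    qed
    have "P \<noteq> 0" using P(2) by auto
    then have PP: "degree (P * P) = 2 * N" "lead_coeff (P * P) = 1"
    proof -
      from \<open>P \<noteq> 0\<close> show "degree (P * P) = 2 * N" using P(1) by (simp add: degree_mult_eq)
      show "lead_coeff (P * P) = 1" unfolding lead_coeff_mult P(2) by simp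
    qed
    have "smult (x\<^sup>2) (Q * Q) = 0 \<or> degree (smult (x\<^sup>2) (Q * Q)) < 2 * N"
    proof (cases "N = 0")
      case False
      then have "degree Q < N"
        by (intro degree_lessI) (auto simp: coeff_Q)
      then show ?thesis
        using degree_smult_le[of "x\<^sup>2" "Q * Q"] degree_mult_le[of Q Q] by simp
    qed (simp add: Q_def)
    then show ?thesis
    proof
      assume "degree (smult (x\<^sup>2) (Q * Q)) < 2 * N"
      then have "degree (- smult (x\<^sup>2) (Q * Q)) < degree (P * P)" using PP by simp
      from lead_coeff_add_le[OF this] show ?thesis
        using PP by (simp add: q_def)
    next
      assume "smult (x\<^sup>2) (Q * Q) = 0"
      then show ?thesis using PP(2) by (simp only: q_def diff_0_right)
    qed
  qed
  moreover have "coeff q i \<in> R" for i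
  proof -
    have "coeff P i \<in> R" "coeff Q i \<in> R" for i
      using ab rat_subalgebraD(1,2)[OF R] by (auto simp: coeff_P coeff_Q)
    then have "coeff (P * P) i \<in> R" "coeff (Q * Q) i \<in> R"
      by (auto intro!: coeff_mult_in_rat_subalgebra[OF R])
    then have "coeff (P * P) i + - (x\<^sup>2 * coeff (Q * Q) i) \<in> R"
      by (intro rat_subalgebraD(3,4,5)[OF R] x)
    then show ?thesis by (simp add: q_def)
  qed
  ultimately show ?thesis unfolding integral_over_def by blast
qed

lemma rat_subalgebra_subset_adjoin:
  assumes "is_rat_subalgebra R"
  shows "R \<subseteq> {a + b * x | a b. a \<in> R \<and> b \<in> R}"
proof
  fix r assume "r \<in> R"
  then show "r \<in> {a + b * x | a b. a \<in> R \<and> b \<in> R}"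
    using rat_subalgebraD(1)[OF assms] by (intro CollectI exI[of _ r] exI[of _ 0]) simp
qed

lemma rat_subalgebra_adjoin_sqrt:
  assumes R: "is_rat_subalgebra R" and x: "x\<^sup>2 \<in> R"
  shows "is_rat_subalgebra {a + b * x | a b. a \<in> R \<and> b \<in> R}" (is "is_rat_subalgebra ?S")
  unfolding is_rat_subalgebra_def
proof (intro conjI ballI)
  show "range of_rat \<subseteq> ?S"
    using R rat_subalgebra_subset_adjoin[OF R, of x] unfolding is_rat_subalgebra_def by blast
next
  fix u v assume "u \<in> ?S" "v \<in> ?S"
  then obtain a b c d where uv: "u = a + b * x" "v = c + d * x"
    and mem: "a \<in> R" "b \<in> R" "c \<in> R" "d \<in> R" by blast
  have "u + v = (a + c) + (b + d) * x" by (simp add: uv algebra_simps)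
  moreover have "a + c \<in> R" "b + d \<in> R" using rat_subalgebraD(3)[OF R] mem by simp_all
  ultimately show "u + v \<in> ?S" by blast
  have "u * v = (a * c + b * d * x\<^sup>2) + (a * d + b * c) * x"
    by (simp add: uv algebra_simps power2_eq_square)
  moreover have "a * c + b * d * x\<^sup>2 \<in> R" "a * d + b * c \<in> R"
    by (intro rat_subalgebraD(3,4)[OF R] mem x)+
  ultimately show "u * v \<in> ?S" by blast
qed

lemma integral_over_remove_sqrts:
  fixes R :: "'a::field_char_0 set"
  assumes "finite F" and "is_rat_subalgebra R" and "\<And>x. x \<in> F \<Longrightarrow> x\<^sup>2 \<in> R"
    and "integral_over (is_rat_subalgebra hull (R \<union> F)) v"
  shows "integral_over R v"
  using assms
proof (induction F arbitrary: R rule: finite_induct)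
  case empty
  then show ?case by (simp add: hull_same)
next
  case (insert x F)
  let ?S = "{a + b * x | a b. a \<in> R \<and> b \<in> R}"
  have x: "x\<^sup>2 \<in> R" using insert.prems(2) by simp
  have S: "is_rat_subalgebra ?S" by (rule rat_subalgebra_adjoin_sqrt[OF insert.prems(1) x])
  have "R \<subseteq> ?S" by (rule rat_subalgebra_subset_adjoin[OF insert.prems(1)])
  moreover have "x \<in> ?S"
    using rat_subalgebraD(1,2)[OF insert.prems(1)]
    by (intro CollectI exI[of _ "0::'a"] exI[of _ "1::'a"]) simp
  ultimately have sub: "R \<union> insert x F \<subseteq> ?S \<union> F" and RS: "R \<subseteq> ?S" by blast+
  have "integral_over ?S v"
  proof (rule insert.IH[OF S])
    show "y\<^sup>2 \<in> ?S" if "y \<in> F" for y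
      using RS insert.prems(2)[OF insertI2[OF that]] by (rule subsetD)
    show "integral_over (is_rat_subalgebra hull (?S \<union> F)) v"
      by (rule integral_over_mono[OF insert.prems(3) hull_mono[OF sub]])
  qed
  then show ?case by (rule integral_over_remove_sqrt[OF insert.prems(1) x])
qed

section \<open>Determinants of bordered matrices with a large zero block\<close>

text \<open>
  Compare the Leibniz expansions. A permutation that contributes must send \<open>Z\<close> into its
  complement; since \<open>Z\<close> fills at least half of the indices, it then exchanges \<open>Z\<close> and the
  complement. Hence no surviving term contains an entry of the complementary diagonal block, which
  is the only place where the two matrices may differ.
\<close>

lemma det_cong_zero_block:
  fixes M M' :: "nat \<Rightarrow> nat \<Rightarrow> 'a::comm_ring_1"
  assumes Z: "Z \<subseteq> {0..<N}" and card: "N \<le> 2 * card Z"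
    and zero: "\<And>r c. r \<in> Z \<Longrightarrow> c \<in> Z \<Longrightarrow> M r c = 0"
    and eq: "\<And>r c. r < N \<Longrightarrow> c < N \<Longrightarrow> r \<in> Z \<or> c \<in> Z \<Longrightarrow> M r c = M' r c"
  shows "det (mat N N (\<lambda>(r, c). M r c)) = det (mat N N (\<lambda>(r, c). M' r c))"
proof -
  have "(\<Prod>i = 0..<N. M i (p i)) = (\<Prod>i = 0..<N. M' i (p i))" if p: "p permutes {0..<N}" for p
  proof (cases "\<exists>i\<in>Z. p i \<in> Z")
    case True
    then obtain i where i: "i \<in> Z" "p i \<in> Z" by blast
    then have N: "i < N" "p i < N" using Z by auto
    have "M i (p i) = 0" by (rule zero[OF i])
    moreover have "M i (p i) = M' i (p i)" using N i by (intro eq) simp_all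
    moreover have "i \<in> {0..<N}" using N by simp
    ultimately have "M i (p i) = 0" "M' i (p i) = 0" "i \<in> {0..<N}" by simp_all
    then show ?thesis by (metis finite_atLeastLessThan prod_zero)
  next
    case False
    have fin: "finite Z" using Z finite_subset by blast
    have "p ` Z \<subseteq> {0..<N} - Z" using False Z permutes_image[OF p] by blast
    moreover have "card ({0..<N} - Z) \<le> card (p ` Z)"
      using card card_image[OF inj_on_subset[OF permutes_inj[OF p] subset_UNIV]]
      by (simp add: card_Diff_subset[OF fin Z])
    ultimately have image: "p ` Z = {0..<N} - Z"
      by (intro card_seteq) auto
    have "i \<in> Z \<or> p i \<in> Z" if "i < N" for i
    proof (rule ccontr)
      assume none: "\<not> (i \<in> Z \<or> p i \<in> Z)"
      have "p i \<in> {0..<N}" using permutes_in_image[OF p, of i] that by simp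
      with none image obtain j where "j \<in> Z" "p j = p i" by (metis DiffI imageE)
      with none show False using permutes_inj[OF p] by (metis injD)
    qed
    then show ?thesis
      using permutes_in_image[OF p] by (intro prod.cong refl eq) auto
  qed
  moreover have "p i < N" if "p permutes {0..<N}" "i < N" for p i
    using permutes_in_image[OF that(1), of i] that(2) by simp
  ultimately show ?thesis
    by (simp add: det_def)
qed

lemma det_add_multiples_of_row0:
  fixes M :: "nat \<Rightarrow> nat \<Rightarrow> 'a::comm_ring_1"
  assumes "u 0 = 0"
  shows "det (mat N N (\<lambda>(r, c). M r c + u r * M 0 c)) = det (mat N N (\<lambda>(r, c). M r c))"
proof -
  let ?L = "mat N N (\<lambda>(r, c). (if r = c then 1 else 0) + (if c = 0 then u r else 0)) :: 'a mat"
  let ?M = "mat N N (\<lambda>(r, c). M r c)"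
  have "det ?L = prod_list (diag_mat ?L)"
    by (rule det_lower_triangular[of N]) auto
  also have "\<dots> = (\<Prod>i = 0..<N. 1)"
    unfolding prod_list_diag_prod by (intro prod.cong) (auto simp: assms)
  finally have L: "det ?L = 1" by simp
  have "mat N N (\<lambda>(r, c). M r c + u r * M 0 c) = ?L * ?M"
    by (rule eq_matI)
      (auto simp: scalar_prod_def distrib_right sum.distrib if_distrib[of "\<lambda>x. x * _"]
        cong: if_cong)
  then show ?thesis using det_mult[of ?L N ?M] L by simp
qed

lemma det_add_multiples_of_col0:
  fixes M :: "nat \<Rightarrow> nat \<Rightarrow> 'a::comm_ring_1"
  assumes "u 0 = 0"
  shows "det (mat N N (\<lambda>(r, c). M r c + u c * M r 0)) = det (mat N N (\<lambda>(r, c). M r c))"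
proof -
  have tr: "det (mat N N (\<lambda>(r, c). F r c)) = det (mat N N (\<lambda>(r, c). F c r))"
    for F :: "nat \<Rightarrow> nat \<Rightarrow> 'a"
  proof -
    have "transpose_mat (mat N N (\<lambda>(r, c). F r c)) = mat N N (\<lambda>(r, c). F c r)" by auto
    then show ?thesis using det_transpose[of "mat N N (\<lambda>(r, c). F r c)" N] by simp
  qed
  show ?thesis
    by (subst (1 2) tr) (rule det_add_multiples_of_row0[where M = "\<lambda>r c. M c r" and u = u], rule assms)
qed

text \<open>
  Cayley--Menger matrices are of this form, with squared distances inside the border.
\<close>

definition bordered :: "(nat \<Rightarrow> nat \<Rightarrow> 'a) \<Rightarrow> nat \<Rightarrow> nat \<Rightarrow> 'a::comm_ring_1" where
  "bordered D r c = (if r = 0 \<or> c = 0 then if r = c then 0 else 1 else D r c)"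

text \<open>
  Subtract \<open>s\<close> times the border row from the other rows outside \<open>Z\<close>, and likewise for
  columns. This undoes a shift by \<open>s\<close> of the mixed blocks and moves it into the diagonal block of
  the complement of \<open>Z\<close>, where a sufficiently large zero block on \<open>Z\<close> makes it invisible to the
  determinant. Index \<open>0\<close> belongs to the complement.
\<close>

lemma det_bordered_shift:
  fixes D D' :: "nat \<Rightarrow> nat \<Rightarrow> 'a::comm_ring_1"
  assumes Z: "Z \<subseteq> {1..<N}" and card: "N \<le> 2 * card Z"
    and zero: "\<And>r c. r \<in> Z \<Longrightarrow> c \<in> Z \<Longrightarrow> D r c = 0"
    and shift: "\<And>r c. 0 < r \<Longrightarrow> 0 < c \<Longrightarrow> r < N \<Longrightarrow> c < N \<Longrightarrow>
      D' r c = D r c + (if (r \<in> Z) = (c \<in> Z) then 0 else s)"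
  shows "det (mat N N (\<lambda>(r, c). bordered D' r c)) = det (mat N N (\<lambda>(r, c). bordered D r c))"
proof -
  define u where "u r = (if r = 0 \<or> r \<in> Z then 0 else - s)" for r
  have u0: "u 0 = 0" by (simp add: u_def)
  define M where "M r c = bordered D' r c + u r * bordered D' 0 c" for r c
  define M' where "M' r c = M r c + u c * M r 0" for r c
  have "det (mat N N (\<lambda>(r, c). bordered D r c)) = det (mat N N (\<lambda>(r, c). M' r c))"
  proof (rule det_cong_zero_block[OF _ card])
    show "Z \<subseteq> {0..<N}" using Z by auto
    show "bordered D r c = 0" if "r \<in> Z" "c \<in> Z" for r c
      using that Z zero by (auto simp: bordered_def)
    show "bordered D r c = M' r c" if "r < N" "c < N" "r \<in> Z \<or> c \<in> Z" for r c
      using that Z by (auto simp: bordered_def M'_def M_def u_def shift)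
  qed
  also have "\<dots> = det (mat N N (\<lambda>(r, c). M r c))"
    unfolding M'_def by (rule det_add_multiples_of_col0[where u = u], rule u0)
  also have "\<dots> = det (mat N N (\<lambda>(r, c). bordered D' r c))"
    unfolding M_def by (rule det_add_multiples_of_row0[where u = u], rule u0)
  finally show ?thesis by simp
qed

section \<open>A one-parameter family of squared edge lengths\<close>

text \<open>
  Vertices of equal parity have distance \<open>0\<close>. The matrix of squared distances between even and
  odd vertices is the identity plus \<open>s\<close> times the all-ones matrix, the partner of \<open>2 a\<close> being
  \<open>2 a + 1\<close>. Any invertible matrix whose inverse has nonzero entry sum could replace the identity.
\<close>

definition family_sq :: "'a::comm_ring_1 \<Rightarrow> nat \<Rightarrow> nat \<Rightarrow> 'a" where
  "family_sq s i j =
     (if even i = even j then 0 else s + (if i div 2 = j div 2 then 1 else 0))"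

text \<open>
  Up to a constant factor this is the squared volume of the face \<open>I\<close> of the simplex with
  parameter \<open>s\<close>.
\<close>

definition family_det :: "nat set \<Rightarrow> 'a::comm_ring_1 \<Rightarrow> 'a" where
  "family_det I s =
     det (mat (card I + 1) (card I + 1)
       (\<lambda>(r, c). bordered (\<lambda>r c. family_sq s (sorted_list_of_set I ! (r - 1))
         (sorted_list_of_set I ! (c - 1))) r c))"

text \<open>
  A face of even dimension has an odd number of vertices, so one of the two parity classes has at
  least one vertex more than the other. Together with the border the other class then makes up at
  most half of the rows, and the dependence on the parameter is invisible.
\<close>

lemma family_det_even_face:
  assumes "odd (card I)"
  shows "family_det I s = family_det I t"
proof -
  define N where "N = card I + 1"
  define v where "v r = sorted_list_of_set I ! (r - 1)" for r
  define E where "E b = {r \<in> {1..<N}. even (v r) = b}" for b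
  have "card (E True) + card (E False) = card (E True \<union> E False)"
    by (rule card_Un_disjoint[symmetric]) (auto simp: E_def)
  also have "E True \<union> E False = {1..<N}" by (auto simp: E_def)
  finally have "card (E True) + card (E False) = card I" by (simp add: N_def)
  then have "N \<le> 2 * card (E True) \<or> N \<le> 2 * card (E False)"
    using assms unfolding N_def by presburger
  then obtain b where b: "N \<le> 2 * card (E b)" by blast
  have "family_det I s = family_det I 0" for s :: 'a
    unfolding family_det_def N_def[symmetric] v_def[symmetric]
  proof (rule det_bordered_shift[OF _ b])
    show "E b \<subseteq> {1..<N}" by (auto simp: E_def)
  qed (auto simp: E_def family_sq_def)
  then show ?thesis by metis
qed

lemma sum_lessThan_pairs: "(\<Sum>j<2 * m. f j) = (\<Sum>a<m. f (2 * a) + f (2 * a + 1))"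
  for f :: "nat \<Rightarrow> 'a::comm_monoid_add"
  by (induction m) (simp_all add: ac_simps)

definition family_full_mat :: "nat \<Rightarrow> 'a::comm_ring_1 \<Rightarrow> 'a mat" where
  "family_full_mat n s =
     mat (n + 2) (n + 2) (\<lambda>(r, c). bordered (\<lambda>r c. family_sq s (r - 1) (c - 1)) r c)"

lemma family_det_full: "family_det {0..n} s = det (family_full_mat n s)"
proof -
  have list: "sorted_list_of_set {0..n} = [0..<n + 1]"
    by (metis atLeastLessThanSuc_atLeastAtMost Suc_eq_plus1 sorted_list_of_set_range)
  have nth: "[0..<n + 1] ! (r - 1) = r - 1" if "r < n + 2" for r
    using that by (subst nth_upt) auto
  show ?thesis
    unfolding family_det_def family_full_mat_def list
    by (intro arg_cong[of _ _ det] cong_mat) (auto simp: nth bordered_def simp del: upt_Suc)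
qed

lemma family_full_mat_mult_vec:
  fixes s :: "'a::comm_ring_1"
  assumes v: "v \<in> carrier_vec (n + 2)"
  shows "(family_full_mat n s *\<^sub>v v) $ 0 = (\<Sum>j<n + 1. v $ Suc j)"
    and "i \<le> n \<Longrightarrow> (family_full_mat n s *\<^sub>v v) $ Suc i =
      v $ 0 + (\<Sum>j<n + 1. family_sq s i j * v $ Suc j)"
proof -
  have entry: "(family_full_mat n s *\<^sub>v v) $ r =
      (\<Sum>c<n + 2. bordered (\<lambda>r c. family_sq s (r - 1) (c - 1)) r c * v $ c)"
    if "r < n + 2" for r
    using that v by (simp add: family_full_mat_def scalar_prod_def atLeast0LessThan)
  have split: "(\<Sum>c<n + 2. f c) = f 0 + (\<Sum>j<n + 1. f (Suc j))" for f :: "nat \<Rightarrow> 'a"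
    using sum.lessThan_Suc_shift[of f "n + 1"] by simp
  show "(family_full_mat n s *\<^sub>v v) $ 0 = (\<Sum>j<n + 1. v $ Suc j)"
    by (subst entry, simp, subst split) (simp add: bordered_def)
  show "(family_full_mat n s *\<^sub>v v) $ Suc i =
      v $ 0 + (\<Sum>j<n + 1. family_sq s i j * v $ Suc j)" if "i \<le> n"
    by (subst entry, use that in simp, subst split) (simp add: bordered_def)
qed

lemma sum_family_sq:
  fixes s :: "'a::comm_ring_1"
  assumes "i < 2 * m"
  shows "(\<Sum>j<2 * m. family_sq s i j * f j) =
    (if even i then f (i + 1) + s * (\<Sum>a<m. f (2 * a + 1))
     else f (i - 1) + s * (\<Sum>a<m. f (2 * a)))"
proof -
  define b where "b = i div 2"
  define e where "e = (if even i then 1 else 0 :: nat)"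
  have b: "b < m" using assms by (simp add: b_def)
  have i: "i = 2 * b + (1 - e)" by (simp add: b_def e_def)
  have "(\<Sum>j<2 * m. family_sq s i j * f j) =
      (\<Sum>a<m. (if a = b then f (2 * a + e) else 0) + s * f (2 * a + e))"
    unfolding sum_lessThan_pairs
  proof (rule sum.cong)
    fix a
    show "family_sq s i (2 * a) * f (2 * a) + family_sq s i (2 * a + 1) * f (2 * a + 1) =
        (if a = b then f (2 * a + e) else 0) + s * f (2 * a + e)"
      unfolding family_sq_def b_def[symmetric] by (auto simp: e_def algebra_simps)
  qed simp
  also have "\<dots> = f (2 * b + e) + s * (\<Sum>a<m. f (2 * a + e))"
    using b by (simp add: sum.distrib sum_distrib_left)
  finally have "(\<Sum>j<2 * m. family_sq s i j * f j) = \<dots>" .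
  moreover have "2 * b + e = (if even i then i + 1 else i - 1)"
    using i by (cases "even i") (simp_all add: e_def)
  ultimately show ?thesis by (simp add: e_def)
qed

text \<open>
  For \<open>s = - 1 / m\<close>, where \<open>m\<close> is the number of pairs, the distance block between the two
  parity classes annihilates the all-ones vector. The vector \<open>1\<close> on the even and \<open>- 1\<close> on the
  odd vertices is then in the kernel; its entries cancel against the border.
\<close>

lemma family_det_full_root:
  assumes "odd n"
  shows "family_det {0..n} (- 1 / of_nat ((n + 1) div 2) :: 'a::field_char_0) = 0"
proof -
  define m where "m = (n + 1) div 2"
  have m: "n + 1 = 2 * m" "m > 0" using assms by (auto simp: m_def elim: oddE)
  define s :: 'a where "s = - 1 / of_nat m"
  have s: "s * of_nat m = - 1" using m(2) by (simp add: s_def)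
  let ?f = "\<lambda>j. (if even j then 1 else - 1) :: 'a"
  define v where "v = vec (n + 2) (\<lambda>r. if r = 0 then 0 else ?f (r - 1))"
  have v: "v \<in> carrier_vec (n + 2)" by (simp add: v_def)
  have v_nth: "v $ 0 = 0" "\<And>j. j < n + 1 \<Longrightarrow> v $ Suc j = ?f j" by (simp_all add: v_def)
  have "(family_full_mat n s *\<^sub>v v) $ r = 0" if "r < n + 2" for r
  proof (cases r)
    case 0
    have "(\<Sum>j<n + 1. v $ Suc j) = (\<Sum>j<2 * m. ?f j)"
      unfolding m(1)[symmetric] by (rule sum.cong) (simp_all add: v_nth)
    then show ?thesis
      using family_full_mat_mult_vec(1)[OF v] by (simp add: 0 sum_lessThan_pairs)
  next
    case (Suc i)
    then have i: "i \<le> n" "i < 2 * m" using that m(1) by auto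
    have "(\<Sum>j<n + 1. family_sq s i j * v $ Suc j) = (\<Sum>j<2 * m. family_sq s i j * ?f j)"
      unfolding m(1)[symmetric] by (rule sum.cong) (simp_all add: v_nth)
    also have "\<dots> = 0" using s by (subst sum_family_sq[OF i(2)]) (auto elim: oddE)
    finally show ?thesis using family_full_mat_mult_vec(2)[OF v i(1)] Suc v_nth(1) by simp
  qed
  then have "family_full_mat n s *\<^sub>v v = 0\<^sub>v (n + 2)"
    by (intro eq_vecI) (simp_all add: family_full_mat_def)
  moreover have "v $ 1 \<noteq> 0\<^sub>v (n + 2) $ 1" by (simp add: v_def)
  ultimately show ?thesis
    unfolding family_det_full s_def[symmetric] m_def[symmetric]
    using v det_0_iff_vec_prod_zero_field[of "family_full_mat n s" "n + 2"]
    by (auto simp: family_full_mat_def)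
qed

text \<open>
  At \<open>s = 0\<close> each vertex has nonzero distance to its partner only, so the equations for a kernel
  vector force all entries to be the negative of the border entry, and the border row then makes
  them vanish. With the root found above, the determinant is a nonconstant function of \<open>s\<close>.
\<close>

lemma family_det_full_0:
  assumes "odd n"
  shows "family_det {0..n} (0 :: 'a::field_char_0) \<noteq> 0"
proof
  define m where "m = (n + 1) div 2"
  have m: "n + 1 = 2 * m" using assms by (auto simp: m_def elim: oddE)
  assume "family_det {0..n} (0 :: 'a) = 0"
  then obtain v where v: "v \<in> carrier_vec (n + 2)" and v0: "v \<noteq> 0\<^sub>v (n + 2)"
    and Mv: "family_full_mat n (0 :: 'a) *\<^sub>v v = 0\<^sub>v (n + 2)"
    unfolding family_det_full
    using det_0_iff_vec_prod_zero_field[of "family_full_mat n (0 :: 'a)" "n + 2"]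
    by (auto simp: family_full_mat_def)
  have partner: "v $ Suc (if even i then i + 1 else i - 1) = - v $ 0" if i: "i \<le> n" for i
  proof -
    from i m have "i < 2 * m" by simp
    moreover have "v $ 0 + (\<Sum>j<2 * m. family_sq 0 i j * v $ Suc j) = 0"
      using family_full_mat_mult_vec(2)[OF v i, of 0] Mv i unfolding m by simp
    ultimately show ?thesis
      by (auto simp: sum_family_sq[where f = "\<lambda>j. v $ Suc j"] add_eq_0_iff split: if_splits)
  qed
  have vj: "v $ Suc j = - v $ 0" if "j \<le> n" for j
  proof -
    have "(if even j then j + 1 else j - 1) \<le> n" using that assms by presburger
    from partner[OF this] show ?thesis by (auto split: if_splits elim: oddE)
  qed
  have "(\<Sum>j<n + 1. v $ Suc j) = 0"
    using family_full_mat_mult_vec(1)[OF v, of 0] Mv by simp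
  moreover have "(\<Sum>j<n + 1. v $ Suc j) = (\<Sum>j<n + 1. - v $ 0)"
    by (rule sum.cong) (auto simp: vj)
  ultimately have "of_nat (n + 1) * v $ 0 = 0" by simp
  then have z: "v $ 0 = 0" by (simp only: mult_eq_0_iff of_nat_eq_0_iff) simp
  have "v = 0\<^sub>v (n + 2)"
  proof (rule eq_vecI)
    fix r assume "r < dim_vec (0\<^sub>v (n + 2) :: 'a vec)"
    then show "v $ r = 0\<^sub>v (n + 2) $ r" using z vj[of "r - 1"] by (cases r) auto
  qed (use v in simp)
  with v0 show False by simp
qed

lemma family_det_poly:
  fixes I :: "nat set"
  obtains q :: "'a::comm_ring_1 poly" where "\<And>s. poly q s = family_det I s"
proof -
  define N where "N = card I + 1"
  define v where "v r = sorted_list_of_set I ! (r - 1)" for r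
  define e :: "nat \<Rightarrow> nat \<Rightarrow> 'a poly"
    where "e = bordered (\<lambda>r c. family_sq [:0, 1:] (v r) (v c))"
  have entry: "poly (e r c) s = bordered (\<lambda>r c. family_sq s (v r) (v c)) r c" for r c s
    by (simp add: e_def bordered_def family_sq_def)
  define q where "q = (\<Sum>p | p permutes {0..<N}. signof p * (\<Prod>i = 0..<N. e i (p i)))"
  have "poly q s = family_det I s" for s
  proof -
    have "p i < N" if "p permutes {0..<N}" "i < N" for p i
      using permutes_in_image[OF that(1), of i] that(2) by simp
    moreover have "poly (signof p) s = signof p" for p by (simp add: sign_def)
    ultimately show ?thesis
      unfolding family_det_def N_def[symmetric] v_def[symmetric]
      by (simp add: q_def det_def poly_sum poly_prod entry)
  qed
  then show thesis by (rule that)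
qed

section \<open>Squared volumes as polynomial functions of the edge lengths\<close>

text \<open>
  The variables are the lengths \<open>x (i, j)\<close> with \<open>i < j\<close>, whereas a Cayley--Menger matrix reads
  lengths in both orders.
\<close>

definition sym_ext :: "(nat \<times> nat \<Rightarrow> 'a) \<Rightarrow> nat \<Rightarrow> nat \<Rightarrow> 'a" where
  "sym_ext x i j = (if i < j then x (i, j) else x (j, i))"

lemma sorted_list_of_set_index:
  assumes "r < card I + 1" and "r \<noteq> 0" and "finite I"
  shows "r - 1 < length (sorted_list_of_set I)" and "sorted_list_of_set I ! (r - 1) \<in> I"
proof -
  show "r - 1 < length (sorted_list_of_set I)" using assms by simp
  from nth_mem[OF this] show "sorted_list_of_set I ! (r - 1) \<in> I" using assms(3) by simp
qed

lemma sq_volume_sym_ext: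
  assumes I: "I \<subseteq> {0..n}" and sym: "\<And>i j. i \<le> n \<Longrightarrow> j \<le> n \<Longrightarrow> l i j = l j i"
  shows "sq_volume (sym_ext (\<lambda>(i, j). l i j)) I = sq_volume l I"
proof -
  have fin: "finite I" using I finite_subset by blast
  have "sym_ext (\<lambda>(i, j). l i j) i j = l i j" if "i \<in> I" "j \<in> I" for i j
    using sym[of i j] that I by (auto simp: sym_ext_def)
  then have "cayley_menger_mat (sym_ext (\<lambda>(i, j). l i j)) I = cayley_menger_mat l I"
    unfolding cayley_menger_mat_def Let_def
    by (intro cong_mat) (auto simp: sorted_list_of_set_index[OF _ _ fin, simplified])
  then show ?thesis by (simp add: sq_volume_def)
qed

lemma rat_poly_fun_sq_volume:
  assumes I: "I \<subseteq> {0..n}"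
  shows "rat_poly_fun (edges n) (\<lambda>x :: nat \<times> nat \<Rightarrow> 'a::field_char_0. sq_volume (sym_ext x) I)"
proof -
  have fin: "finite I" using I finite_subset by blast
  define N where "N = card I + 1"
  define v where "v r = sorted_list_of_set I ! (r - 1)" for r
  have const: "rat_poly_fun (edges n) (\<lambda>x. c)" if "c = of_rat d" for c :: 'a and d
    using rat_poly_fun_const[of "edges n" d] that by simp
  have entry: "rat_poly_fun (edges n) (\<lambda>x :: nat \<times> nat \<Rightarrow> 'a. cayley_menger_mat (sym_ext x) I $$ (r, c))"
    if rc: "r < N" "c < N" for r c
  proof (cases "r = 0 \<or> c = 0 \<or> r = c")
    case True
    then have "cayley_menger_mat (sym_ext x) I $$ (r, c) = (if r = c then 0 else 1)"
      for x :: "nat \<times> nat \<Rightarrow> 'a"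
      using rc by (auto simp: cayley_menger_mat_def Let_def N_def)
    then show ?thesis using const[of 0 0] const[of 1 1] by simp
  next
    case False
    have mem: "v r \<in> I" "v c \<in> I"
      using sorted_list_of_set_index(2)[OF _ _ fin] rc False by (auto simp: N_def v_def)
    have "v r \<noteq> v c"
      using rc False sorted_list_of_set_index(1)[OF _ _ fin]
      unfolding v_def N_def by (subst nth_eq_iff_index_eq) auto
    then have "v r < v c \<and> (v r, v c) \<in> edges n \<or> \<not> v r < v c \<and> (v c, v r) \<in> edges n"
      using mem I by (auto simp: edges_def)
    moreover have "cayley_menger_mat (sym_ext x) I $$ (r, c) = (sym_ext x (v r) (v c))\<^sup>2"
      for x :: "nat \<times> nat \<Rightarrow> 'a"
      using rc False by (simp add: cayley_menger_mat_def Let_def N_def v_def)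
    ultimately show ?thesis
      by (auto simp: sym_ext_def intro!: rat_poly_fun_power rat_poly_fun_var)
  qed
  have "rat_poly_fun (edges n) (\<lambda>x. det (cayley_menger_mat (sym_ext x :: nat \<Rightarrow> nat \<Rightarrow> 'a) I))"
  proof -
    have dim: "cayley_menger_mat (sym_ext x) I \<in> carrier_mat N N" for x :: "nat \<times> nat \<Rightarrow> 'a"
      by (simp add: cayley_menger_mat_def Let_def N_def)
    show ?thesis
      unfolding det_def'[OF dim]
    proof (intro rat_poly_fun_sum rat_poly_fun_mult rat_poly_fun_prod)
      fix p assume "p \<in> {p. p permutes {0..<N}}"
      show "rat_poly_fun (edges n) (\<lambda>x. signof p :: 'a)"
        by (rule const[of _ "signof p"]) (simp add: sign_def of_rat_minus)
    next
      fix p i assume "p \<in> {p. p permutes {0..<N}}" "i \<in> {0..<N}"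
      then show "rat_poly_fun (edges n)
          (\<lambda>x :: nat \<times> nat \<Rightarrow> 'a. cayley_menger_mat (sym_ext x) I $$ (i, p i))"
        using permutes_in_image[of p "{0..<N}" i] by (intro entry) auto
    qed
  qed
  moreover have "of_rat (fact i) = (fact i :: 'a)" for i
    by (metis of_nat_fact of_rat_of_nat_eq)
  ultimately show ?thesis
    unfolding sq_volume_def Let_def
    by (intro rat_poly_fun_mult
        const[of _ "(- 1) ^ (card I - 1 + 1) / (2 ^ (card I - 1) * (fact (card I - 1))\<^sup>2)"])
      (simp_all add: of_rat_divide of_rat_mult of_rat_power of_rat_minus)
qed

lemma det_cayley_menger_mat_family:
  assumes x: "\<And>i j. (sym_ext x i j)\<^sup>2 = family_sq s i j"
  shows "det (cayley_menger_mat (sym_ext x) I) = family_det I s"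
  unfolding cayley_menger_mat_def family_det_def Let_def x
  by (intro arg_cong[of _ _ det] cong_mat) (auto simp: bordered_def family_sq_def)

section \<open>Volumes along the family\<close>

definition family_length :: "'a::alg_closed_field \<Rightarrow> nat \<times> nat \<Rightarrow> 'a" where
  "family_length s = (\<lambda>(i, j). SOME y. y\<^sup>2 = family_sq s i j)"

lemma family_length_sq: "(sym_ext (family_length s) i j)\<^sup>2 = family_sq s i j"
proof -
  have "(family_length s (i, j))\<^sup>2 = family_sq s i j" for i j
    unfolding family_length_def prod.case
    by (rule someI_ex[of "\<lambda>y. y\<^sup>2 = family_sq s i j"]) (simp add: nth_root_exists)
  moreover have "family_sq s j i = family_sq s i j" by (simp add: family_sq_def eq_commute)
  ultimately show ?thesis by (simp add: sym_ext_def)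
qed

definition volume_coeff :: "nat \<Rightarrow> 'a::field_char_0" where
  "volume_coeff k = (- 1) ^ (k + 1) / (2 ^ k * (fact k)\<^sup>2)"

lemma sq_volume_family:
  "sq_volume (sym_ext (family_length s)) I =
    volume_coeff (card I - 1) * family_det I s"
  using det_cayley_menger_mat_family[OF family_length_sq]
  by (simp add: sq_volume_def Let_def volume_coeff_def)

text \<open>
  The squared volume is a polynomial in the parameter, and it is not constant because it has a
  root but does not vanish at \<open>0\<close>. It therefore takes each value only finitely often.
\<close>

lemma sq_volume_family_infinite:
  fixes F :: "'a::{field_char_0, alg_closed_field} set"
  assumes "odd n" and "finite F"
  obtains s where "sq_volume (sym_ext (family_length s)) {0..n} \<notin> F"
proof -
  let ?c = "volume_coeff n :: 'a"
  obtain q :: "'a poly" where q: "\<And>s. poly q s = family_det {0..n} s"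
    using family_det_poly[of "{0..n}"] by blast
  have "finite {s. poly (smult ?c q - [:w:]) s = 0}" for w
  proof (rule poly_roots_finite)
    show "smult ?c q - [:w:] \<noteq> 0"
    proof
      assume "smult ?c q - [:w:] = 0"
      then have eq: "smult ?c q = [:w:]" by simp
      have "?c * family_det {0..n} s = w" for s
        using arg_cong[OF eq, of "\<lambda>p. poly p s"] by (simp add: q)
      from this[of "- 1 / of_nat ((n + 1) div 2)"] this[of 0]
      have "?c * family_det {0..n} 0 = 0"
        by (simp only: family_det_full_root[OF assms(1)] mult_zero_right)
      moreover have "?c \<noteq> 0" by (simp add: volume_coeff_def)
      moreover have "family_det {0..n} (0 :: 'a) \<noteq> 0" by (rule family_det_full_0[OF assms(1)])
      ultimately show False by simp
    qed
  qed
  then have "finite (\<Union>w\<in>F. {s. poly (smult ?c q - [:w:]) s = 0})"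
    by (intro finite_UN_I assms(2))
  from ex_new_if_finite[OF infinite_UNIV_char_0 this]
  obtain s where s: "s \<notin> (\<Union>w\<in>F. {s. poly (smult ?c q - [:w:]) s = 0})" ..
  have "?c * family_det {0..n} s \<notin> F"
  proof
    assume "?c * family_det {0..n} s \<in> F"
    with s have "poly (smult ?c q - [:?c * family_det {0..n} s:]) s \<noteq> 0" by blast
    then show False by (simp add: q)
  qed
  then have "sq_volume (sym_ext (family_length s)) {0..n} \<notin> F"
    by (simp add: sq_volume_family)
  then show thesis by (rule that)
qed

section \<open>Non-integrality of the volume\<close>

text \<open>
  Separating even and odd powers isolates the dependence on the sign of \<open>v\<close>: everything else is
  a function of \<open>v\<^sup>2\<close>.
\<close>

lemma poly_split_parity:
  fixes v :: "'a::comm_ring_1"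
  shows "(\<Sum>i\<le>N. f i * v ^ i) =
    (\<Sum>i | i \<le> N \<and> even i. f i * (v\<^sup>2) ^ (i div 2)) +
    v * (\<Sum>i | i \<le> N \<and> odd i. f i * (v\<^sup>2) ^ (i div 2))"
proof -
  have "(\<Sum>i\<le>N. f i * v ^ i) =
      (\<Sum>i | i \<le> N \<and> even i. f i * v ^ i) + (\<Sum>i | i \<le> N \<and> odd i. f i * v ^ i)"
    by (subst sum.union_disjoint[symmetric]) (auto intro: sum.cong)
  also have "(\<Sum>i | i \<le> N \<and> even i. f i * v ^ i) =
      (\<Sum>i | i \<le> N \<and> even i. f i * (v\<^sup>2) ^ (i div 2))"
    by (rule sum.cong) (auto simp: power_mult[symmetric])
  also have "(\<Sum>i | i \<le> N \<and> odd i. f i * v ^ i) =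
      v * (\<Sum>i | i \<le> N \<and> odd i. f i * (v\<^sup>2) ^ (i div 2))"
    unfolding sum_distrib_left
  proof (rule sum.cong)
    fix i assume "i \<in> {i. i \<le> N \<and> odd i}"
    then obtain j where "i = 2 * j + 1" by (auto elim: oddE)
    then show "f i * v ^ i = v * (f i * (v\<^sup>2) ^ (i div 2))" by (simp add: power_mult)
  qed simp
  finally show ?thesis .
qed

text \<open>
  \<open>V\<close> itself is only a square root of a polynomial function, so its equation \<open>a + V b = 0\<close>
  cannot be specialised directly. Its consequence \<open>a\<^sup>2 = W b\<^sup>2\<close> can. At the new point this
  factors into the equations for the two square roots of \<open>W\<close>, one of which has to hold.
\<close>

lemma integral_equation_transfer:
  fixes x y :: "'v \<Rightarrow> 'a::field_char_0"
  assumes indep: "alg_independent_rat B x"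
    and f: "\<And>i. rat_poly_fun B (f i)" and W: "rat_poly_fun B W"
    and V: "V\<^sup>2 = W x" and root: "(\<Sum>i\<le>N. f i x * V ^ i) = 0"
    and v: "v\<^sup>2 = W y"
  shows "(\<Sum>i\<le>N. f i y * v ^ i) = 0 \<or> (\<Sum>i\<le>N. f i y * (- v) ^ i) = 0"
proof -
  define a where "a = (\<lambda>z. \<Sum>i | i \<le> N \<and> even i. f i z * W z ^ (i div 2))"
  define b where "b = (\<lambda>z. \<Sum>i | i \<le> N \<and> odd i. f i z * W z ^ (i div 2))"
  have split: "(\<Sum>i\<le>N. f i z * u ^ i) = a z + u * b z" if "u\<^sup>2 = W z" for u z
    unfolding poly_split_parity[of "\<lambda>i. f i z"] that a_def b_def ..
  have "a x = - V * b x" using root split[OF V] by (simp add: add_eq_0_iff2)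
  then have sq_x: "(a x)\<^sup>2 = W x * (b x)\<^sup>2" by (simp add: power_mult_distrib V)
  have a: "rat_poly_fun B a" and b: "rat_poly_fun B b"
    unfolding a_def b_def
    by (intro rat_poly_fun_sum rat_poly_fun_mult rat_poly_fun_power f W)+
  have sq: "(a y)\<^sup>2 = W y * (b y)\<^sup>2"
    by (rule rat_poly_fun_eq_transfer[where f = "\<lambda>z. (a z)\<^sup>2" and g = "\<lambda>z. W z * (b z)\<^sup>2",
          OF indep rat_poly_fun_power[OF a] rat_poly_fun_mult[OF W rat_poly_fun_power[OF b]] sq_x])
  have "(a y + v * b y) * (a y + (- v) * b y) = (a y)\<^sup>2 - v\<^sup>2 * (b y)\<^sup>2"
    by (simp add: algebra_simps power2_eq_square)
  also have "\<dots> = 0" by (simp add: sq v)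
  finally have "(a y + v * b y) * (a y + (- v) * b y) = 0" .
  then show ?thesis using split[of v y] split[of "- v" y] v by auto
qed

theorem corollary1p6:
  fixes n k :: nat
    and l :: "nat \<Rightarrow> nat \<Rightarrow> 'a :: {field_char_0, alg_closed_field}"
    and A :: "nat set \<Rightarrow> 'a"
    and V :: 'a
  assumes l_sym: "\<And>i j. i \<le> n \<Longrightarrow> j \<le> n \<Longrightarrow> l i j = l j i"
    and l_indep: "alg_independent_rat (edges n) (\<lambda>(i, j). l i j)"
    and closure: "\<And>x :: 'a. algebraic_over (is_subfield hull ((\<lambda>(i, j). l i j) ` edges n)) x"
    and A_sqrt: "\<And>I. I \<in> faces n k \<Longrightarrow> (A I)\<^sup>2 = sq_volume l I"
    and V_sqrt: "V\<^sup>2 = sq_volume l {0..n}"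
    and "odd n" and "even k" and "0 < k" and "k < n" and "k \<noteq> 4"
  shows "\<not> integral_over (is_rat_subalgebra hull (A ` faces n k)) V"
proof
  assume int: "integral_over (is_rat_subalgebra hull (A ` faces n k)) V"
  define x where "x = (\<lambda>(i, j). l i j)"
  define W :: "(nat \<times> nat \<Rightarrow> 'a) \<Rightarrow> 'a" where "W z = sq_volume (sym_ext z) {0..n}" for z
  (* Values of the polynomials that are constant along the family. This subalgebra contains the
     squares of the even-dimensional face volumes. *)
  define R where "R = {f x | f. rat_poly_fun (edges n) f \<and>
    (\<forall>s. f (family_length s) = f (family_length 0))}"
  have indep: "alg_independent_rat (edges n) x" using l_indep by (simp add: x_def)
  have W: "rat_poly_fun (edges n) W"
    unfolding W_def by (rule rat_poly_fun_sq_volume) simp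
  have V: "V\<^sup>2 = W x"
    using V_sqrt sq_volume_sym_ext[of "{0..n}" n l] l_sym by (simp add: W_def x_def)
  have R: "is_rat_subalgebra R"
    unfolding is_rat_subalgebra_def
  proof (intro conjI ballI subsetI)
    fix r :: 'a assume "r \<in> range of_rat"
    then obtain q where "r = of_rat q" by blast
    then show "r \<in> R"
      unfolding R_def using rat_poly_fun_const by (intro CollectI exI[of _ "\<lambda>_. of_rat q"]) simp
  next
    fix u v assume "u \<in> R" "v \<in> R"
    then obtain f g where fg: "u = f x" "v = g x"
      and poly: "rat_poly_fun (edges n) f" "rat_poly_fun (edges n) g"
      and const: "\<forall>s. f (family_length s) = f (family_length 0)"
        "\<forall>s. g (family_length s) = g (family_length 0)"
      unfolding R_def by blast
    have "f (family_length s) + g (family_length s) = f (family_length 0) + g (family_length 0)"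
      "f (family_length s) * g (family_length s) = f (family_length 0) * g (family_length 0)" for s
      by (simp_all only: const(1)[rule_format, of s] const(2)[rule_format, of s])
    note const' = this
    show "u + v \<in> R"
      unfolding R_def fg
      by (intro CollectI exI[of _ "\<lambda>x. f x + g x"] conjI allI refl
          rat_poly_fun_add poly const'(1))
    show "u * v \<in> R"
      unfolding R_def fg
      by (intro CollectI exI[of _ "\<lambda>x. f x * g x"] conjI allI refl
          rat_poly_fun_mult poly const'(2))
  qed
  have "sq_volume l I \<in> R" if I: "I \<in> faces n k" for I
  proof -
    have sub: "I \<subseteq> {0..n}" and card: "card I = k + 1" using I by (auto simp: faces_def)
    have "sq_volume (sym_ext (family_length s)) I = sq_volume (sym_ext (family_length 0)) I"
      for s :: 'a
      using family_det_even_face[of I s 0] card \<open>even k\<close> by (simp only: sq_volume_family) simp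
    moreover have "sq_volume l I = sq_volume (sym_ext x) I"
      unfolding x_def using sq_volume_sym_ext[OF sub, of l] l_sym by simp
    ultimately show ?thesis
      unfolding R_def using rat_poly_fun_sq_volume[OF sub]
      by (intro CollectI exI[of _ "\<lambda>x. sq_volume (sym_ext x) I"] conjI allI)
  qed
  then have A: "a\<^sup>2 \<in> R" if "a \<in> A ` faces n k" for a
    using that A_sqrt by auto
  have "finite (faces n k)"
    by (rule finite_subset[of _ "Pow {0..n}"]) (auto simp: faces_def)
  then have fin: "finite (A ` faces n k)" by (rule finite_imageI)
  have "integral_over (is_rat_subalgebra hull (R \<union> A ` faces n k)) V"
    by (rule integral_over_mono[OF int hull_mono]) simp
  from integral_over_remove_sqrts[OF fin R _ this] A have "integral_over R V" by simp
  then obtain p where monic: "lead_coeff p = 1" and coeff: "\<forall>i. coeff p i \<in> R"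
    and root: "poly p V = 0"
    unfolding integral_over_def by blast
  from coeff have "\<forall>i. \<exists>f. coeff p i = f x \<and> rat_poly_fun (edges n) f \<and>
      (\<forall>s. f (family_length s) = f (family_length 0))"
    unfolding R_def by blast
  then obtain f where f: "\<And>i. coeff p i = f i x" "\<And>i. rat_poly_fun (edges n) (f i)"
    "\<And>i s. f i (family_length s) = f i (family_length 0)"
    by metis
  define N where "N = degree p"
  (* The specialised equation is the same for all parameters, so the squares of its roots are
     the only values that the squared volume can take along the family. *)
  define P where "P = (\<Sum>i\<le>N. monom (f i (family_length 0)) i)"
  have poly_P: "poly P v = (\<Sum>i\<le>N. f i (family_length 0) * v ^ i)" for v
    by (simp add: P_def poly_sum poly_monom)
  have "coeff P N = f N (family_length 0)" by (simp add: P_def coeff_sum)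
  also have "\<dots> = 1"
    using rat_poly_fun_eq_transfer[OF indep f(2) rat_poly_fun_const[of _ 1], of N] monic
    by (simp add: N_def f(1))
  finally have "P \<noteq> 0" by auto
  then have "finite ((\<lambda>v. v\<^sup>2) ` {v. poly P v = 0})" by (intro finite_imageI poly_roots_finite)
  then obtain s where s: "W (family_length s) \<notin> (\<lambda>v. v\<^sup>2) ` {v. poly P v = 0}"
    unfolding W_def by (rule sq_volume_family_infinite[OF \<open>odd n\<close>])
  obtain v where v: "v\<^sup>2 = W (family_length s)"
    using nth_root_exists[of 2 "W (family_length s)"] by auto
  have "(\<Sum>i\<le>N. f i x * V ^ i) = 0" using root by (simp add: poly_altdef f(1) N_def)
  from integral_equation_transfer[where f = f and W = W, OF indep f(2) W V this v]
  have "poly P v = 0 \<or> poly P (- v) = 0" by (simp add: poly_P f(3)[of _ s])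
  then obtain u where u: "poly P u = 0" "u\<^sup>2 = v\<^sup>2" by (metis power2_minus)
  then have "W (family_length s) \<in> (\<lambda>v. v\<^sup>2) ` {v. poly P v = 0}"
    unfolding v[symmetric] u(2)[symmetric] by simp
  with s show False by contradiction
qed

end
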